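(* There is an injective group homomorphism $\mathrm{QAut}(\mathcal{T}_{2,c}) \to V$, where $V$ is R. Thompson's group $V$.
   Context: $\{0,1\}^*$ is the set of finite words over $\{0,1\}$ (including the empty word $\varepsilon$). $\mathcal{T}_{2,c}$ is the infinite rooted binary tree with vertex set $\{0,1\}^*$, in which each vertex $w$ is joined to its left child $w0$ by a red edge and to its right child $w1$ by a blue edge. $\mathrm{QAut}(\mathcal{T}_{2,c})$ is the group (under composition) of all bijections $\tau$ of the vertex set $\{0,1\}^*$ which respect the edge and color relationships except at possibly finitely many locations; equivalently, bijections $\tau:\{0,1\}^*\to\{0,1\}^*$ (acting on the right) such that $(wa)\tau=(w\tau)a$ for all but finitely many pairs $(w,a)\in\{0,1\}^*\times\{0,1\}$. R. Thompson's group $V$ is the group of homeomorphisms of the Cantor set $\{0,1\}^{\omega}$ (infinite words) that are given by prefix replacement: there are two finite complete anti-chains $\{a_1,\dots,a_n\}$ and $\{b_1,\dots,b_n\}$ of $\{0,1\}^*$ (ordered by the prefix relation) such that the map sends $a_i z\mapsto b_i z$ for all $i$ and all $z\in\{0,1\}^{\omega}$. A finite anti-chain is complete if it is maximal with respect to inclusion among anti-chains. *)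

theory Defs
  imports
    "HOL-Analysis.Function_Topology"
    "HOL-Library.Sublist"
    "HOL-Library.Omega_Words_Fun"
    "HOL-Algebra.Group"
begin

text \<open>
  The letters 0 and 1 are encoded as \<^term>\<open>False\<close> and \<^term>\<open>True\<close>; the vertices of the coloured
  binary tree are the words of type \<^typ>\<open>bool list\<close>, and the edge from \<open>w\<close> to its child \<open>w @ [a]\<close>
  is red for \<open>a = False\<close> and blue for \<open>a = True\<close>.  Maps act on the right, so the product of
  \<open>\<sigma>\<close> and \<open>\<tau>\<close> (first \<open>\<sigma>\<close>, then \<open>\<tau>\<close>) is \<open>\<tau> \<circ> \<sigma>\<close>.
\<close>

definition QAut :: "(bool list \<Rightarrow> bool list) monoid" where
  "QAut = \<lparr> carrier = {\<tau>. bij \<tau> \<and> finite {(w, a). \<tau> (w @ [a]) \<noteq> \<tau> w @ [a]}},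
            mult = (\<lambda>\<sigma> \<tau>. \<tau> \<circ> \<sigma>),
            one = id \<rparr>"

definition antichain :: "'a list set \<Rightarrow> bool" where
  "antichain A \<longleftrightarrow> pairwise (\<parallel>) A"

definition complete_antichain :: "'a list set \<Rightarrow> bool" where
  "complete_antichain A \<longleftrightarrow> antichain A \<and> (\<forall>B. antichain B \<and> A \<subseteq> B \<longrightarrow> B = A)"

text \<open>
  The lists \<open>as\<close> and \<open>bs\<close> enumerate the two finite complete antichains without repetition.
\<close>

definition prefix_replacement :: "('a word \<Rightarrow> 'a word) \<Rightarrow> bool" where
  "prefix_replacement f \<longleftrightarrow>
     (\<exists>as bs. length as = length bs \<and> distinct as \<and> distinct bs \<and>
        complete_antichain (set as) \<and> complete_antichain (set bs) \<and>
        (\<forall>i < length as. \<forall>z. f (as ! i \<frown> z) = bs ! i \<frown> z))"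

text \<open>
  The Cantor set is the type \<^typ>\<open>bool word\<close>, that is \<^typ>\<open>nat \<Rightarrow> bool\<close>, whose type class
  topology is the product of the discrete topologies on the factors.
\<close>

definition Thompson_V :: "(bool word \<Rightarrow> bool word) monoid" where
  "Thompson_V = \<lparr> carrier = {f. homeomorphic_map euclidean euclidean f \<and> prefix_replacement f},
                  mult = (\<lambda>f g. g \<circ> f),
                  one = id \<rparr>"

end

theory Submission
  imports Defs
begin

text \<open>
  The idea is to give every vertex \<open>w\<close> of the tree a cone of the Cantor set that belongs to the
  vertex alone.  Encode the letters 0 and 1 by the words 00 and 01, and let the cone of \<open>w\<close> be
  \<open>code w \<frown> 1 \<frown> z\<close>.  These cones are pairwise disjoint and their union is dense; the points that
  they miss are the codes of the infinite words.  An element \<open>\<tau>\<close> of \<^term>\<open>QAut\<close> permutes the cones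
  by \<open>code w \<frown> 1 \<frown> z \<mapsto> code (\<tau> w) \<frown> 1 \<frown> z\<close>.  From some depth \<open>N\<close> on, \<open>\<tau>\<close> is given by
  \<open>\<tau> (w @ u) = \<tau> w @ u\<close>, so on the set of all \<open>code w \<frown> z\<close> with \<open>length w = N\<close> the permutation
  of cones is the prefix replacement \<open>code w \<frown> z \<mapsto> code (\<tau> w) \<frown> z\<close>, which makes sense for the
  missed points as well.  Hence the permutation of cones extends to an element of \<open>V\<close>
  (lemma \<open>realizes_exists\<close>).  Since the cones are dense, the extension is unique
  (lemma \<open>realizes_unique\<close>), so it is multiplicative in \<open>\<tau>\<close>; and it is injective because it
  remembers where each single vertex goes.

  It is convenient to describe \<open>V\<close> without antichains.  A bijection of the Cantor set is a prefix
  replacement between complete antichains iff it replaces prefixes on the words of some uniform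
  length (lemma \<open>prefix_replacement_iff_tail_replacing\<close>).  The latter condition is visibly stable
  under composition and implies continuity; the former is visibly stable under inversion, because
  the two antichains change places.
\<close>

(* inv is the inverse of a function throughout, not the inverse in a group. *)
unbundle no m_inv_syntax

section \<open>Finite prefixes and complete antichains\<close>

lemma conc_eq_conc_cases:
  assumes "v \<frown> x = w \<frown> y"
  obtains u where "w = v @ u" "x = u \<frown> y" | u where "v = w @ u" "y = u \<frown> x"
proof -
  have split: "\<exists>u. w' = v' @ u \<and> x' = u \<frown> y'"
    if eq: "v' \<frown> x' = w' \<frown> y'" and le: "length v' \<le> length w'"
    for v' w' :: "'a list" and x' y'
  proof -
    let ?n = "length v'"
    have "v' \<frown> x' = take ?n w' \<frown> (drop ?n w' \<frown> y')"
      using eq by simp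
    with le have "v' = take ?n w' \<and> x' = drop ?n w' \<frown> y'"
      by (subst (asm) concat_eq) auto
    then show ?thesis
      by (metis append_take_drop_id)
  qed
  show ?thesis
    using split[OF assms] split[OF assms[symmetric]] that nat_le_linear by blast
qed

lemma conc_eq_conc_imp_not_parallel: "v \<frown> x = w \<frown> y \<Longrightarrow> \<not> v \<parallel> w"
  by (erule conc_eq_conc_cases) auto

lemma complete_antichain_iff:
  "complete_antichain A \<longleftrightarrow> antichain A \<and> (\<forall>w. \<exists>a\<in>A. \<not> w \<parallel> a)"
proof (intro iffI conjI allI)
  fix w
  assume A: "complete_antichain A"
  show "\<exists>a\<in>A. \<not> w \<parallel> a"
  proof (rule ccontr)
    assume par: "\<not> (\<exists>a\<in>A. \<not> w \<parallel> a)"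
    then have "antichain (insert w A)"
      using A by (auto simp: complete_antichain_def antichain_def pairwise_insert parallel_commute)
    then have "w \<in> A"
      using A by (auto simp: complete_antichain_def)
    with par show False
      by auto
  qed
next
  assume A: "antichain A \<and> (\<forall>w. \<exists>a\<in>A. \<not> w \<parallel> a)"
  have "B \<subseteq> A" if "antichain B" "A \<subseteq> B" for B
    using A that unfolding antichain_def pairwise_def by (metis subset_iff)
  then show "complete_antichain A"
    using A by (auto simp: complete_antichain_def)
qed (simp add: complete_antichain_def)

section \<open>Replacing prefixes of a uniform length\<close>

definition tail_replacing :: "('a word \<Rightarrow> 'a word) \<Rightarrow> bool" where
  "tail_replacing f \<longleftrightarrow> (\<exists>N. \<forall>u. length u = N \<longrightarrow> (\<exists>v. \<forall>z. f (u \<frown> z) = v \<frown> z))"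

text \<open>
  Reading \<open>M\<close> further letters, which are copied to the output, makes the replacing word \<open>v\<close> at
  least \<open>M\<close> letters long.
\<close>

lemma tail_replacing_long:
  assumes "tail_replacing f"
  obtains N where "\<And>u. length u = N \<Longrightarrow> \<exists>v. M \<le> length v \<and> (\<forall>z. f (u \<frown> z) = v \<frown> z)"
proof -
  obtain N where N: "\<And>u. length u = N \<Longrightarrow> \<exists>v. \<forall>z. f (u \<frown> z) = v \<frown> z"
    using assms by (auto simp: tail_replacing_def)
  have "\<exists>v. M \<le> length v \<and> (\<forall>z. f (u \<frown> z) = v \<frown> z)" if u: "length u = N + M" for u
  proof -
    obtain v where v: "\<And>z. f (take N u \<frown> z) = v \<frown> z"
      using N[of "take N u"] u by auto
    have "f (u \<frown> z) = (v @ drop N u) \<frown> z" for z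
      using v[of "drop N u \<frown> z"] by simp
    then show ?thesis
      using u by (intro exI[of _ "v @ drop N u"]) auto
  qed
  then show ?thesis
    using that by blast
qed

lemma tail_replacing_id: "tail_replacing id"
  by (auto simp: tail_replacing_def)

lemma tail_replacing_comp:
  assumes "tail_replacing f" "tail_replacing g"
  shows "tail_replacing (g \<circ> f)"
proof -
  obtain M where M: "\<And>u. length u = M \<Longrightarrow> \<exists>v. \<forall>z. g (u \<frown> z) = v \<frown> z"
    using assms(2) by (auto simp: tail_replacing_def)
  obtain N where N: "\<And>u. length u = N \<Longrightarrow> \<exists>v. M \<le> length v \<and> (\<forall>z. f (u \<frown> z) = v \<frown> z)"
    using tail_replacing_long[OF assms(1), of M] by blast
  have "\<exists>v. \<forall>z. (g \<circ> f) (u \<frown> z) = v \<frown> z" if u: "length u = N" for u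
  proof -
    obtain v where v: "M \<le> length v" "\<And>z. f (u \<frown> z) = v \<frown> z"
      using N[OF u] by blast
    obtain v' where v': "\<And>z. g (take M v \<frown> z) = v' \<frown> z"
      using M[of "take M v"] v(1) by auto
    have "(g \<circ> f) (u \<frown> z) = (v' @ drop M v) \<frown> z" for z
      using v(2)[of z] v'[of "drop M v \<frown> z"] by simp
    then show ?thesis
      by blast
  qed
  then show ?thesis
    by (auto simp: tail_replacing_def)
qed

text \<open>
  This is continuity in a combinatorial form.  It yields the topological one, and it shows that
  such a map is determined by its values on any set of points that realizes all finite prefixes.
\<close>

lemma tail_replacing_finitely_determined:
  assumes "tail_replacing f"
  obtains n where "\<And>x y. (\<And>i. i < n \<Longrightarrow> x i = y i) \<Longrightarrow> f x k = f y k"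
proof -
  obtain N where N: "\<And>u. length u = N \<Longrightarrow> \<exists>v. Suc k \<le> length v \<and> (\<forall>z. f (u \<frown> z) = v \<frown> z)"
    using tail_replacing_long[OF assms, of "Suc k"] by blast
  have "f x k = f y k" if eq: "\<And>i. i < N \<Longrightarrow> x i = y i" for x y
  proof -
    obtain u x' where x: "x = u \<frown> x'" "length u = N"
      using word_split[of x N] by metis
    obtain u' y' where y: "y = u' \<frown> y'" "length u' = N"
      using word_split[of y N] by metis
    have "u = u'"
      using eq x y by (intro nth_equalityI) (auto simp: conc_def)
    moreover obtain v where "Suc k \<le> length v" "\<And>z. f (u \<frown> z) = v \<frown> z"
      using N x(2) by blast
    ultimately show ?thesis
      using x y by simp
  qed
  then show ?thesis
    using that by blast
qed

lemma continuous_tail_replacing: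
  fixes f :: "bool word \<Rightarrow> bool word"
  assumes "tail_replacing f"
  shows "continuous_on UNIV f"
proof (rule continuous_on_coordinatewise_then_product)
  fix k
  obtain n where n: "\<And>x y. (\<And>i. i < n \<Longrightarrow> x i = y i) \<Longrightarrow> f x k = f y k"
    using tail_replacing_finitely_determined[OF assms, of k] by blast
  have "open ((\<lambda>x. f x k) -` B)" for B
  proof (subst open_subopen, intro ballI)
    fix x
    assume x: "x \<in> (\<lambda>x. f x k) -` B"
    have "open {y. \<forall>i\<in>{..<n}. y i \<in> {x i}}"
      by (rule product_topology_basis') (auto intro: open_discrete)
    moreover have "{y. \<forall>i\<in>{..<n}. y i \<in> {x i}} \<subseteq> (\<lambda>x. f x k) -` B"
    proof
      fix y
      assume "y \<in> {y. \<forall>i\<in>{..<n}. y i \<in> {x i}}"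
      then have "f y k = f x k"
        by (intro n) auto
      then show "y \<in> (\<lambda>x. f x k) -` B"
        using x by simp
    qed
    ultimately show "\<exists>T. open T \<and> x \<in> T \<and> T \<subseteq> (\<lambda>x. f x k) -` B"
      by blast
  qed
  then show "continuous_on UNIV (\<lambda>x. f x k)"
    by (simp add: continuous_on_open_vimage)
qed

text \<open>
  For a bijection that replaces the prefixes \<open>u\<close> of length \<open>N\<close> by \<open>v u\<close>, injectivity makes the
  words \<open>v u\<close> an antichain and surjectivity makes this antichain complete.  Conversely, every word
  that is at least as long as all members of a finite complete antichain has a member as a prefix.
\<close>

lemma prefix_replacement_iff_tail_replacing:
  fixes f :: "'a::finite word \<Rightarrow> 'a word"
  assumes "bij f"
  shows "prefix_replacement f \<longleftrightarrow> tail_replacing f"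
proof
  assume "prefix_replacement f"
  then obtain as bs where ab: "length as = length bs" "complete_antichain (set as)"
      "\<And>i z. i < length as \<Longrightarrow> f (as ! i \<frown> z) = bs ! i \<frown> z"
    unfolding prefix_replacement_def by blast
  define N where "N = Max (insert 0 (length ` set as))"
  have "\<exists>v. \<forall>z. f (u \<frown> z) = v \<frown> z" if u: "length u = N" for u
  proof -
    obtain i where i: "i < length as" "\<not> u \<parallel> as ! i"
      using ab(2) unfolding complete_antichain_iff by (metis in_set_conv_nth)
    have "length (as ! i) \<le> length u"
      using i(1) unfolding u N_def by (intro Max_ge) auto
    with i(2) obtain t where t: "u = as ! i @ t"
      unfolding parallel_def by (metis prefix_length_le le_antisym prefix_def append_eq_append_conv
          append_Nil2)
    have "f (u \<frown> z) = (bs ! i @ t) \<frown> z" for z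
      using ab(3)[OF i(1), of "t \<frown> z"] t by simp
    then show ?thesis
      by blast
  qed
  then show "tail_replacing f"
    by (auto simp: tail_replacing_def)
next
  assume "tail_replacing f"
  then obtain N where "\<forall>u. \<exists>v. length u = N \<longrightarrow> (\<forall>z. f (u \<frown> z) = v \<frown> z)"
    unfolding tail_replacing_def by blast
  then obtain v where v: "\<And>u z. length u = N \<Longrightarrow> f (u \<frown> z) = v u \<frown> z"
    by metis
  have inj: "inj f"
    using assms by (rule bij_is_inj)
  have fin: "finite {u :: 'a list. length u = N}"
    using finite_lists_length_eq[of "UNIV :: 'a set" N] by simp
  obtain us where us: "set us = {u :: 'a list. length u = N}" "distinct us"
    using finite_distinct_list[OF fin] by blast
  have prefix_imp_eq: "u = u'"
    if len: "length u = N" "length u' = N" and pre: "Sublist.prefix (v u) (v u')" for u u'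
  proof -
    obtain t where t: "v u' = v u @ t"
      using pre by (auto elim: prefixE)
    have "f (u' \<frown> undefined) = f (u \<frown> (t \<frown> undefined))"
      using v[OF len(2), of undefined] v[OF len(1), of "t \<frown> undefined"] t by simp
    with inj have "u' \<frown> undefined = u \<frown> (t \<frown> undefined)"
      by (simp only: inj_eq)
    then show "u = u'"
      using len concat_eq[of u' u] by blast
  qed
  have "distinct (map v us)"
    using us prefix_imp_eq by (simp add: distinct_map inj_on_def)
  moreover have "complete_antichain (set us)"
  proof -
    have "\<exists>a. length a = N \<and> \<not> w \<parallel> a" for w :: "'a list"
    proof -
      obtain a x where "w \<frown> undefined = a \<frown> x" "length a = N"
        using word_split[of "w \<frown> undefined" N] by metis
      then show ?thesis
        using conc_eq_conc_imp_not_parallel by blast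
    qed
    moreover have "u \<parallel> u'" if "length u = N" "length u' = N" "u \<noteq> u'" for u u' :: "'a list"
      using that by (auto simp: parallel_def prefix_def)
    ultimately show ?thesis
      unfolding complete_antichain_iff us(1) antichain_def pairwise_def by blast
  qed
  moreover have "complete_antichain (set (map v us))"
  proof -
    have "\<exists>u. length u = N \<and> \<not> w \<parallel> v u" for w :: "'a list"
    proof -
      obtain y where y: "f y = w \<frown> undefined"
        using assms by (metis bij_pointE)
      obtain u x where "y = u \<frown> x" "length u = N"
        using word_split[of y N] by metis
      then have "w \<frown> undefined = v u \<frown> x"
        using v y by simp
      then show ?thesis
        using conc_eq_conc_imp_not_parallel \<open>length u = N\<close> by blast
    qed
    moreover have "v u \<parallel> v u'" if "length u = N" "length u' = N" "v u \<noteq> v u'" for u u'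
      using that prefix_imp_eq[of u u'] prefix_imp_eq[of u' u] by (auto simp: parallel_def)
    ultimately show ?thesis
      unfolding complete_antichain_iff set_map us(1) antichain_def pairwise_def by blast
  qed
  moreover have "\<forall>i < length us. \<forall>z. f (us ! i \<frown> z) = map v us ! i \<frown> z"
  proof (intro allI impI)
    fix i z
    assume i: "i < length us"
    then have "length (us ! i) = N"
      using us(1) nth_mem by blast
    then show "f (us ! i \<frown> z) = map v us ! i \<frown> z"
      using v i by simp
  qed
  ultimately show "prefix_replacement f"
    unfolding prefix_replacement_def using us(2) by (intro exI[of _ us] exI[of _ "map v us"]) simp
qed

lemma prefix_replacement_inv:
  assumes "inj f" "prefix_replacement f"
  shows "prefix_replacement (inv f)"
proof -
  obtain as bs where ab: "length as = length bs" "distinct as" "distinct bs"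
      "complete_antichain (set as)" "complete_antichain (set bs)"
      "\<And>i z. i < length as \<Longrightarrow> f (as ! i \<frown> z) = bs ! i \<frown> z"
    using assms(2) unfolding prefix_replacement_def by blast
  have "inv f (bs ! i \<frown> z) = as ! i \<frown> z" if "i < length bs" for i z
    using ab(1,6) that assms(1) by (metis inv_f_f)
  then show ?thesis
    unfolding prefix_replacement_def using ab by (intro exI[of _ bs] exI[of _ as]) simp
qed

lemma tail_replacing_inv:
  fixes f :: "'a::finite word \<Rightarrow> 'a word"
  assumes "bij f" "tail_replacing f"
  shows "tail_replacing (inv f)"
  using assms prefix_replacement_inv[of f]
  by (simp add: prefix_replacement_iff_tail_replacing[symmetric] bij_imp_bij_inv bij_is_inj)

section \<open>Both structures are groups\<close>

lemma carrier_Thompson_V: "carrier Thompson_V = {f. bij f \<and> tail_replacing f}"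
proof -
  have "homeomorphic_map euclidean euclidean f \<and> prefix_replacement f \<longleftrightarrow> bij f \<and> tail_replacing f"
    for f :: "bool word \<Rightarrow> bool word"
  proof (intro iffI)
    assume f: "homeomorphic_map euclidean euclidean f \<and> prefix_replacement f"
    then have "bij f"
      by (simp add: homeomorphic_eq_everything_map bij_def)
    then show "bij f \<and> tail_replacing f"
      using f prefix_replacement_iff_tail_replacing by blast
  next
    assume f: "bij f \<and> tail_replacing f"
    then have "continuous_on UNIV f" "continuous_on UNIV (inv f)"
      by (simp_all add: continuous_tail_replacing tail_replacing_inv)
    with f have "homeomorphic_maps euclidean euclidean f (inv f)"
      by (simp add: homeomorphic_maps_def bij_is_inj bij_is_surj surj_f_inv_f)
    then show "homeomorphic_map euclidean euclidean f \<and> prefix_replacement f"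
      using f homeomorphic_maps_imp_map prefix_replacement_iff_tail_replacing by blast
  qed
  then show ?thesis
    by (simp add: Thompson_V_def)
qed

lemma mult_Thompson_V: "f \<otimes>\<^bsub>Thompson_V\<^esub> g = g \<circ> f"
  by (simp add: Thompson_V_def)

lemma one_Thompson_V: "\<one>\<^bsub>Thompson_V\<^esub> = id"
  by (simp add: Thompson_V_def)

lemma group_Thompson_V: "group Thompson_V"
proof (rule groupI)
  fix f
  assume "f \<in> carrier Thompson_V"
  then have "bij f" "tail_replacing f"
    by (auto simp: carrier_Thompson_V)
  then show "\<exists>g\<in>carrier Thompson_V. g \<otimes>\<^bsub>Thompson_V\<^esub> f = \<one>\<^bsub>Thompson_V\<^esub>"
    by (intro bexI[of _ "inv f"])
      (auto simp: carrier_Thompson_V mult_Thompson_V one_Thompson_V tail_replacing_inv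
        bij_imp_bij_inv bij_is_surj[THEN surj_iff[THEN iffD1]])
qed (auto simp: carrier_Thompson_V mult_Thompson_V one_Thompson_V tail_replacing_comp
    tail_replacing_id bij_comp comp_assoc)

definition defects :: "(bool list \<Rightarrow> bool list) \<Rightarrow> (bool list \<times> bool) set" where
  "defects \<tau> = {(w, a). \<tau> (w @ [a]) \<noteq> \<tau> w @ [a]}"

lemma carrier_QAut: "carrier QAut = {\<tau>. bij \<tau> \<and> finite (defects \<tau>)}"
  by (simp add: QAut_def defects_def)

lemma mult_QAut: "\<sigma> \<otimes>\<^bsub>QAut\<^esub> \<tau> = \<tau> \<circ> \<sigma>"
  by (simp add: QAut_def)

lemma one_QAut: "\<one>\<^bsub>QAut\<^esub> = id"
  by (simp add: QAut_def)

lemma defects_id: "defects id = {}"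
  by (simp add: defects_def)

lemma finite_defects_comp:
  assumes "inj \<sigma>" "finite (defects \<sigma>)" "finite (defects \<tau>)"
  shows "finite (defects (\<tau> \<circ> \<sigma>))"
proof -
  have "inj (map_prod \<sigma> (id :: bool \<Rightarrow> bool))"
    using assms(1) by (simp add: prod.inj_map)
  then have "finite (map_prod \<sigma> id -` defects \<tau>)"
    using assms(3) by (simp add: finite_vimageI)
  moreover have "defects (\<tau> \<circ> \<sigma>) \<subseteq> defects \<sigma> \<union> map_prod \<sigma> id -` defects \<tau>"
    by (auto simp: defects_def)
  ultimately show ?thesis
    using assms(2) by (meson finite_UnI finite_subset)
qed

lemma finite_defects_inv:
  assumes "bij \<tau>" "finite (defects \<tau>)"
  shows "finite (defects (inv \<tau>))"
proof -
  have "(v, a) \<in> map_prod \<tau> id ` defects \<tau>" if d: "(v, a) \<in> defects (inv \<tau>)" for v a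
  proof -
    have v: "v = \<tau> (inv \<tau> v)"
      using assms(1) by (simp add: bij_is_surj surj_f_inv_f)
    have "\<tau> (inv \<tau> v @ [a]) \<noteq> v @ [a]"
      using d assms(1) by (auto simp: defects_def bij_is_inj dest: sym)
    then have "(inv \<tau> v, a) \<in> defects \<tau>"
      using v by (simp add: defects_def)
    then have "map_prod \<tau> id (inv \<tau> v, a) \<in> map_prod \<tau> id ` defects \<tau>"
      by (rule imageI)
    then show ?thesis
      using v by simp
  qed
  then have "defects (inv \<tau>) \<subseteq> map_prod \<tau> id ` defects \<tau>"
    by auto
  then show ?thesis
    using assms(2) by (meson finite_imageI finite_subset)
qed

lemma group_QAut: "group QAut"
proof (rule groupI)
  fix \<tau>
  assume "\<tau> \<in> carrier QAut"
  then have "bij \<tau>" "finite (defects \<tau>)"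
    by (auto simp: carrier_QAut)
  then show "\<exists>\<sigma>\<in>carrier QAut. \<sigma> \<otimes>\<^bsub>QAut\<^esub> \<tau> = \<one>\<^bsub>QAut\<^esub>"
    by (intro bexI[of _ "inv \<tau>"])
      (auto simp: carrier_QAut mult_QAut one_QAut finite_defects_inv
        bij_imp_bij_inv bij_is_surj[THEN surj_iff[THEN iffD1]])
qed (auto simp: carrier_QAut mult_QAut one_QAut finite_defects_comp defects_id bij_comp bij_is_inj
    comp_assoc)

lemma finite_defects_imp_stable:
  assumes "finite (defects \<tau>)"
  obtains N where "\<And>w u. length w = N \<Longrightarrow> \<tau> (w @ u) = \<tau> w @ u"
proof -
  (* N exceeds the length of every word at which a defect occurs. *)
  define N where "N = Suc (Max (insert 0 ((length \<circ> fst) ` defects \<tau>)))"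
  have step: "\<tau> (w @ [a]) = \<tau> w @ [a]" if "N \<le> length w" for w a
  proof (rule ccontr)
    assume "\<tau> (w @ [a]) \<noteq> \<tau> w @ [a]"
    then have "(w, a) \<in> defects \<tau>"
      by (simp add: defects_def)
    then have "length w \<in> insert 0 ((length \<circ> fst) ` defects \<tau>)"
      by force
    then have "length w < N"
      unfolding N_def less_Suc_eq_le using assms by (intro Max_ge) auto
    with that show False
      by simp
  qed
  have "\<tau> (w @ u) = \<tau> w @ u" if "length w = N" for w u
    using that
  proof (induction u rule: rev_induct)
    case (snoc a u)
    then show ?case
      using step[of "w @ u" a] by simp
  qed simp
  then show ?thesis
    using that by blast
qed

section \<open>Vertices as cones of the Cantor set\<close>

definition code :: "bool list \<Rightarrow> bool list" where
  "code w = concat (map (\<lambda>a. [False, a]) w)"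

definition vertex_point :: "bool list \<Rightarrow> bool word \<Rightarrow> bool word" where
  "vertex_point w z = code w \<frown> True ## z"

lemma code_simps [simp]:
  "code [] = []" "code (a # w) = False # a # code w" "code (w @ u) = code w @ code u"
  by (simp_all add: code_def)

lemma code_conc_vertex_point: "code w \<frown> vertex_point u z = vertex_point (w @ u) z"
  by (simp add: vertex_point_def)

text \<open>
  The marker 1 of the vertex \<open>w'\<close> stands at an even position, where a code has only 0, so \<open>code w\<close>
  ends before the marker.
\<close>

lemma code_conc_eq_vertex_pointD:
  assumes "code w \<frown> x = vertex_point w' z"
  shows "\<exists>u. w' = w @ u \<and> x = vertex_point u z"
  using assms
proof (induction w arbitrary: w')
  case (Cons a w)
  then show ?case
    by (cases w') (auto simp: vertex_point_def)
qed simp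

lemma vertex_point_eq_iff: "vertex_point w z = vertex_point w' z' \<longleftrightarrow> w = w' \<and> z = z'"
proof
  assume "vertex_point w z = vertex_point w' z'"
  then show "w = w' \<and> z = z'"
  proof (induction w arbitrary: w')
    case Nil
    then show ?case
      by (cases w') (auto simp: vertex_point_def)
  next
    case (Cons a w)
    then show ?case
      by (cases w') (auto simp: vertex_point_def)
  qed
qed simp

text \<open>
  Read in blocks of two letters, a word is a code until the first block that starts with 1; that
  block marks the vertex whose cone has been entered.
\<close>

lemma even_word_cases:
  assumes "length u = 2 * N"
  obtains w where "length w = N" "u = code w" | w t where "u = code w @ True # t"
proof -
  have "(\<exists>w. length w = N \<and> u = code w) \<or> (\<exists>w t. u = code w @ True # t)"
    using assms
  proof (induction N arbitrary: u)
    case (Suc N)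
    then obtain b a r where u: "u = b # a # r" "length r = 2 * N"
      by (auto simp: length_Suc_conv)
    show ?case
    proof (cases b)
      case True
      then have "u = code [] @ True # a # r"
        using u by simp
      then show ?thesis
        by blast
    next
      case False
      have "(\<exists>w. length w = N \<and> r = code w) \<or> (\<exists>w t. r = code w @ True # t)"
        using Suc.IH u(2) .
      then show ?thesis
      proof (elim disjE exE conjE)
        fix w
        assume "length w = N" "r = code w"
        then have "length (a # w) = Suc N \<and> u = code (a # w)"
          using u False by simp
        then show ?thesis
          by blast
      next
        fix w t
        assume "r = code w @ True # t"
        then have "u = code (a # w) @ True # t"
          using u False by simp
        then show ?thesis
          by blast
      qed
    qed
  qed simp
  then show ?thesis
    using that by blast
qed

lemma vertex_points_dense:
  obtains w z where "\<And>i. i < n \<Longrightarrow> vertex_point w z i = x i"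
proof -
  obtain u y where x: "x = u \<frown> y" "length u = 2 * n"
    using word_split[of x "2 * n"] by metis
  from x(2) show ?thesis
  proof (cases rule: even_word_cases)
    case (1 w)
    have "vertex_point w y i = x i" if "i < n" for i
      using that x 1 by (simp add: vertex_point_def)
    then show ?thesis
      using that by blast
  next
    case (2 w t)
    have "vertex_point w (t \<frown> y) = x"
      using x 2 by (simp add: vertex_point_def)
    then show ?thesis
      using that by blast
  qed
qed

section \<open>The embedding\<close>

definition realizes :: "(bool word \<Rightarrow> bool word) \<Rightarrow> (bool list \<Rightarrow> bool list) \<Rightarrow> bool" where
  "realizes f \<tau> \<longleftrightarrow>
     tail_replacing f \<and> (\<forall>w z. f (vertex_point w z) = vertex_point (\<tau> w) z)"

text \<open>
  Only vertex points have a prescribed image, so \<open>f\<close> may be built one prefix \<open>u\<close> at a time: it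
  suffices to find, for each \<open>u\<close> of length \<open>2 * N\<close>, a replacement that is right for the vertex
  points that begin with \<open>u\<close>.  Either \<open>u\<close> is the code of a word \<open>w0\<close> of length \<open>N\<close>, and below \<open>w0\<close>
  the map \<open>\<tau>\<close> copies the remaining letters; or \<open>u\<close> lies in the cone of a single vertex.
\<close>

lemma realizes_exists:
  assumes "finite (defects \<tau>)"
  obtains f where "realizes f \<tau>"
proof -
  obtain N where N: "\<And>w u. length w = N \<Longrightarrow> \<tau> (w @ u) = \<tau> w @ u"
    using finite_defects_imp_stable[OF assms] by blast
  have "\<exists>v. length u = 2 * N \<longrightarrow>
      (\<forall>x w z. u \<frown> x = vertex_point w z \<longrightarrow> v \<frown> x = vertex_point (\<tau> w) z)" for u
  proof (cases "length u = 2 * N")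
    case True
    then show ?thesis
    proof (cases rule: even_word_cases)
      case (1 w0)
      have "code (\<tau> w0) \<frown> x = vertex_point (\<tau> w) z" if eq: "u \<frown> x = vertex_point w z" for x w z
      proof -
        obtain t where "w = w0 @ t" "x = vertex_point t z"
          using code_conc_eq_vertex_pointD eq 1(2) by blast
        then show ?thesis
          using N[OF 1(1), of t] by (simp only: code_conc_vertex_point)
      qed
      then show ?thesis
        by blast
    next
      case (2 w0 t)
      have "(code (\<tau> w0) @ True # t) \<frown> x = vertex_point (\<tau> w) z"
        if "u \<frown> x = vertex_point w z" for x w z
      proof -
        have "vertex_point w0 (t \<frown> x) = vertex_point w z"
          using that 2 by (simp add: vertex_point_def)
        then have "w = w0" "z = t \<frown> x"
          by (simp_all add: vertex_point_eq_iff)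
        then show ?thesis
          by (simp add: vertex_point_def)
      qed
      then show ?thesis
        by blast
    qed
  qed simp
  then obtain v where v: "\<And>u x w z. length u = 2 * N \<Longrightarrow> u \<frown> x = vertex_point w z \<Longrightarrow>
      v u \<frown> x = vertex_point (\<tau> w) z"
    by metis
  define f where
    "f x = v (Omega_Words_Fun.prefix (2 * N) x) \<frown> Omega_Words_Fun.suffix (2 * N) x" for x
  have "f (u \<frown> z) = v u \<frown> z" if "length u = 2 * N" for u z
    using that by (simp add: f_def)
  then have "tail_replacing f"
    by (auto simp: tail_replacing_def)
  moreover have "f (vertex_point w z) = vertex_point (\<tau> w) z" for w z
    unfolding f_def by (rule v) simp_all
  ultimately show ?thesis
    using that unfolding realizes_def by blast
qed

text \<open>
  Each letter of \<open>f x\<close> and \<open>g x\<close> depends on finitely many letters of \<open>x\<close> only, and these can be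
  completed to a vertex point.
\<close>

lemma realizes_unique:
  assumes "realizes f \<tau>" "realizes g \<tau>"
  shows "f = g"
proof (intro ext)
  fix x k
  obtain m where m: "\<And>x y. (\<And>i. i < m \<Longrightarrow> x i = y i) \<Longrightarrow> f x k = f y k"
    using tail_replacing_finitely_determined[of f k] assms(1) unfolding realizes_def by blast
  obtain n where n: "\<And>x y. (\<And>i. i < n \<Longrightarrow> x i = y i) \<Longrightarrow> g x k = g y k"
    using tail_replacing_finitely_determined[of g k] assms(2) unfolding realizes_def by blast
  obtain w z where wz: "\<And>i. i < max m n \<Longrightarrow> vertex_point w z i = x i"
    using vertex_points_dense[of "max m n" x] by blast
  have "f x k = f (vertex_point w z) k"
    using wz by (intro m) simp
  also have "\<dots> = g (vertex_point w z) k"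
    using assms by (simp add: realizes_def)
  also have "\<dots> = g x k"
    using wz by (intro n) simp
  finally show "f x k = g x k" .
qed

lemma realizes_id: "realizes id id"
  by (simp add: realizes_def tail_replacing_id)

lemma realizes_comp: "realizes f \<sigma> \<Longrightarrow> realizes g \<tau> \<Longrightarrow> realizes (g \<circ> f) (\<tau> \<circ> \<sigma>)"
  by (simp add: realizes_def tail_replacing_comp)

lemma realizes_imp_eq:
  assumes "realizes f \<sigma>" "realizes f \<tau>"
  shows "\<sigma> = \<tau>"
proof
  fix w
  have "vertex_point (\<sigma> w) undefined = vertex_point (\<tau> w) undefined"
    using assms unfolding realizes_def by metis
  then show "\<sigma> w = \<tau> w"
    by (simp add: vertex_point_eq_iff)
qed

text \<open>
  Uniqueness also gives bijectivity: the composites with a realization of the inverse of \<open>\<tau>\<close>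
  realize the identity permutation, so they are the identity.
\<close>

lemma realizes_imp_Thompson_V:
  assumes "\<tau> \<in> carrier QAut" "realizes f \<tau>"
  shows "f \<in> carrier Thompson_V"
proof -
  have \<tau>: "bij \<tau>" "finite (defects \<tau>)"
    using assms(1) by (auto simp: carrier_QAut)
  then obtain g where g: "realizes g (inv \<tau>)"
    using realizes_exists finite_defects_inv by blast
  have "realizes (g \<circ> f) id" "realizes (f \<circ> g) id"
    using realizes_comp[OF assms(2) g] realizes_comp[OF g assms(2)] \<tau>(1)
    by (simp_all add: bij_is_inj bij_is_surj[THEN surj_iff[THEN iffD1]])
  then have "g \<circ> f = id" "f \<circ> g = id"
    using realizes_unique realizes_id by blast+
  then have "bij f"
    by (rule o_bij)
  then show ?thesis
    using assms(2) by (simp add: carrier_Thompson_V realizes_def)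
qed

theorem theorem4:
  shows "\<exists>\<phi>. group_hom QAut Thompson_V \<phi> \<and> inj_on \<phi> (carrier QAut)"
proof -
  have "\<exists>f. realizes f \<tau>" if "\<tau> \<in> carrier QAut" for \<tau>
    using that realizes_exists unfolding carrier_QAut by blast
  then obtain \<phi> where \<phi>: "\<And>\<tau>. \<tau> \<in> carrier QAut \<Longrightarrow> realizes (\<phi> \<tau>) \<tau>"
    by metis
  have "\<phi> (\<tau> \<circ> \<sigma>) = \<phi> \<tau> \<circ> \<phi> \<sigma>" if "\<sigma> \<in> carrier QAut" "\<tau> \<in> carrier QAut" for \<sigma> \<tau>
  proof -
    have "\<tau> \<circ> \<sigma> \<in> carrier QAut"
      using monoid.m_closed[OF group.is_monoid[OF group_QAut] that] by (simp add: mult_QAut)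
    then have "realizes (\<phi> (\<tau> \<circ> \<sigma>)) (\<tau> \<circ> \<sigma>)"
      by (rule \<phi>)
    moreover have "realizes (\<phi> \<tau> \<circ> \<phi> \<sigma>) (\<tau> \<circ> \<sigma>)"
      using that by (intro realizes_comp \<phi>)
    ultimately show ?thesis
      by (rule realizes_unique)
  qed
  then have "\<phi> \<in> hom QAut Thompson_V"
    using realizes_imp_Thompson_V[OF _ \<phi>] by (simp add: hom_def mult_QAut mult_Thompson_V)
  moreover have "inj_on \<phi> (carrier QAut)"
  proof (rule inj_onI)
    fix \<sigma> \<tau>
    assume "\<sigma> \<in> carrier QAut" "\<tau> \<in> carrier QAut" "\<phi> \<sigma> = \<phi> \<tau>"
    then show "\<sigma> = \<tau>"
      using \<phi>[of \<sigma>] \<phi>[of \<tau>] by (intro realizes_imp_eq[of "\<phi> \<tau>"]) simp_all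
  qed
  ultimately show ?thesis
    using group_QAut group_Thompson_V
    by (intro exI[of _ \<phi>] conjI group_hom.intro group_hom_axioms.intro)
qed

end
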